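(* Let $\mathbf{V}$ be a variety of rings. Then every ring $R\in\mathbf{V}$ is equationally Noetherian (that is, $\mathcal{L}_r(R)$-equationally Noetherian) if and only if every ring in $\mathbf{V}$ has zero multiplication, i.e. for every $R\in\mathbf{V}$ one has $ab=0$ for all $a,b\in R$.
   Context: $\mathcal{L}_r=\{+,-,\cdot,0\}$ is the language of rings (rings are not assumed to be unital or commutative), and for a ring $R$, $\mathcal{L}_r(R)$ is $\mathcal{L}_r$ extended by a constant symbol for every element of $R$ (interpreted as that element). An $\mathcal{L}_r(R)$-equation is an equality $p(X)=q(X)$ of two terms of $\mathcal{L}_r(R)$. A system of equations is an arbitrary (possibly infinite) set of equations in a finite set of variables $X=\{x_1,\dots,x_n\}$; its solution set in $R$ is a subset of $R^n$, and two systems are equivalent over $R$ if they have the same solution set in $R$. The ring $R$ is called equationally Noetherian if every infinite system $\mathbf{S}$ of $\mathcal{L}_r(R)$-equations (in finitely many variables) is equivalent over $R$ to some finite subsystem $\mathbf{S}'\subseteq\mathbf{S}$. A variety of rings is a class of rings consisting of all rings satisfying some given set of identities in the language $\mathcal{L}_r$. *)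

theory Defs
  imports "HOL-Algebra.Ring" "HOL-Library.FuncSet"
begin

text \<open>
  The library locale \<open>ring\<close> demands a unit, so rings that need not be unital are built here on
  \<open>abelian_group\<close>. The record field \<open>one\<close> is left unconstrained and is never used.
\<close>

locale nonunital_ring = abelian_group R for R (structure) +
  assumes mult_closed: "\<lbrakk>x \<in> carrier R; y \<in> carrier R\<rbrakk> \<Longrightarrow> x \<otimes> y \<in> carrier R"
    and mult_assoc: "\<lbrakk>x \<in> carrier R; y \<in> carrier R; z \<in> carrier R\<rbrakk>
      \<Longrightarrow> (x \<otimes> y) \<otimes> z = x \<otimes> (y \<otimes> z)"
    and distrib_right: "\<lbrakk>x \<in> carrier R; y \<in> carrier R; z \<in> carrier R\<rbrakk>
      \<Longrightarrow> (x \<oplus> y) \<otimes> z = x \<otimes> z \<oplus> y \<otimes> z"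
    and distrib_left: "\<lbrakk>x \<in> carrier R; y \<in> carrier R; z \<in> carrier R\<rbrakk>
      \<Longrightarrow> z \<otimes> (x \<oplus> y) = z \<otimes> x \<oplus> z \<otimes> y"

text \<open>
  Terms with variables in \<open>'v\<close> and constant symbols in \<open>'c\<close>. Terms of the pure ring language
  are those with \<open>rconsts t = {}\<close>; terms of the language with constants from \<open>R\<close> are those
  with \<open>rconsts t \<subseteq> carrier R\<close>. The minus symbol is unary.
\<close>

datatype (rvars: 'v, rconsts: 'c) rterm =
    Var 'v
  | Const 'c
  | Zero
  | Plus "('v, 'c) rterm" "('v, 'c) rterm"
  | Neg "('v, 'c) rterm"
  | Times "('v, 'c) rterm" "('v, 'c) rterm"

primrec eval_rterm :: "('a, 'm) ring_scheme \<Rightarrow> ('v \<Rightarrow> 'a) \<Rightarrow> ('v, 'a) rterm \<Rightarrow> 'a" where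
  "eval_rterm R x (Var v) = x v"
| "eval_rterm R x (Const c) = c"
| "eval_rterm R x Zero = \<zero>\<^bsub>R\<^esub>"
| "eval_rterm R x (Plus s t) = eval_rterm R x s \<oplus>\<^bsub>R\<^esub> eval_rterm R x t"
| "eval_rterm R x (Neg t) = \<ominus>\<^bsub>R\<^esub> eval_rterm R x t"
| "eval_rterm R x (Times s t) = eval_rterm R x s \<otimes>\<^bsub>R\<^esub> eval_rterm R x t"

text \<open>An equation \<open>p = q\<close>, and likewise an identity, is represented by the pair \<open>(p, q)\<close>.\<close>

type_synonym 'a equation = "(nat, 'a) rterm \<times> (nat, 'a) rterm"

definition ring_equation :: "('a, 'm) ring_scheme \<Rightarrow> nat \<Rightarrow> 'a equation \<Rightarrow> bool" where
  "ring_equation R n = (\<lambda>(p, q).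
     rvars p \<subseteq> {..<n} \<and> rvars q \<subseteq> {..<n} \<and>
     rconsts p \<subseteq> carrier R \<and> rconsts q \<subseteq> carrier R)"

definition solution_set :: "('a, 'm) ring_scheme \<Rightarrow> nat \<Rightarrow> 'a equation set \<Rightarrow> (nat \<Rightarrow> 'a) set" where
  "solution_set R n S =
     {x \<in> {..<n} \<rightarrow>\<^sub>E carrier R. \<forall>(p, q)\<in>S. eval_rterm R x p = eval_rterm R x q}"

definition equationally_noetherian :: "('a, 'm) ring_scheme \<Rightarrow> bool" where
  "equationally_noetherian R \<longleftrightarrow>
     (\<forall>n S. infinite S \<and> (\<forall>e\<in>S. ring_equation R n e) \<longrightarrow>
        (\<exists>S'\<subseteq>S. finite S' \<and> solution_set R n S' = solution_set R n S))"

definition ring_identity :: "'a equation \<Rightarrow> bool" where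
  "ring_identity = (\<lambda>(p, q). rconsts p = {} \<and> rconsts q = {})"

definition satisfies_identity :: "('a, 'm) ring_scheme \<Rightarrow> 'a equation \<Rightarrow> bool" where
  "satisfies_identity R = (\<lambda>(p, q).
     \<forall>x \<in> UNIV \<rightarrow> carrier R. eval_rterm R x p = eval_rterm R x q)"

text \<open>
  A class of rings is rendered as the set of its members with carrier contained in the type
  \<open>'a\<close>, which plays the role of a universe. When \<open>'a\<close> is infinite it accommodates,
  up to isomorphism, all countable rings. (Over a finite type all rings would be finite, hence
  equationally Noetherian, so infinitude of the universe is needed in results about varieties.)
\<close>

definition ring_variety :: "'a ring set \<Rightarrow> bool" where
  "ring_variety V \<longleftrightarrow>
     (\<exists>E. (\<forall>e\<in>E. ring_identity e) \<and>
          V = {R. nonunital_ring R \<and> (\<forall>e\<in>E. satisfies_identity R e)})"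

end

theory Submission
  imports Defs "HOL-Library.Countable_Set"
begin

text \<open>
  Suppose a ring \<open>R\<close> of the variety contains \<open>a\<close>, \<open>b\<close> with \<open>a b \<noteq> 0\<close>. In the power \<open>R\<^sup>\<nat>\<close>
  let \<open>\<alpha>\<^sub>k\<close> be \<open>a\<close> placed in coordinate \<open>k\<close> with zeros elsewhere, and \<open>\<beta>\<^sub>k\<close> likewise for \<open>b\<close>.
  Then \<open>\<alpha>\<^sub>k \<beta>\<^sub>l = 0\<close> holds exactly when \<open>k \<noteq> l\<close>. Hence \<open>\<beta>\<^sub>l\<close> solves every finite part of the
  system \<open>\<alpha>\<^sub>k x = 0\<close> (\<open>k \<in> \<nat>\<close>) that omits the equation number \<open>l\<close>, but not the whole system
  (\<open>equationally_noetherian_no_orthogonal_sequences\<close>). The subring generated by the \<open>\<alpha>\<^sub>k\<close> and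
  \<open>\<beta>\<^sub>k\<close> satisfies the identities of \<open>R\<close>, because identities hold coordinatewise
  (\<open>ring_variety_subpower\<close>), and it is countable, so it has a copy inside any infinite universe
  (\<open>subpower_with_orthogonal_sequences\<close>). So the variety contains a ring that is not
  equationally Noetherian.

  Conversely, if all products in \<open>R\<close> vanish, every term is an affine function
  \<open>m\<^sub>0 x\<^sub>0 + \<dots> + m\<^sub>n\<^sub>-\<^sub>1 x\<^sub>n\<^sub>-\<^sub>1 + c\<close> with integer coefficients (\<open>eval_affine\<close>). The group \<open>\<int>\<^sup>n\<close> is
  Noetherian, so finitely many equations \<open>F\<close> of a system \<open>S\<close> have coefficient vectors that
  generate those of all of \<open>S\<close> (\<open>int_span_finitely_generated\<close>). The linear part of each
  equation in \<open>S\<close> is then constant on the solution set of \<open>F\<close>, so that equation holds at all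
  solutions of \<open>F\<close> or at none of them. If all equations are of the first kind, \<open>F\<close> is equivalent
  to \<open>S\<close>; if some \<open>e \<in> S\<close> is of the second kind, \<open>F \<union> {e}\<close> is already inconsistent, and so
  is \<open>S\<close>.
\<close>

section \<open>Evaluation of terms\<close>

context nonunital_ring
begin

lemma zero_mult_left: "x \<in> carrier R \<Longrightarrow> \<zero> \<otimes> x = \<zero>"
  using distrib_right[of \<zero> \<zero> x] mult_closed[of \<zero> x] add.r_cancel_one' by auto

lemma zero_mult_right: "x \<in> carrier R \<Longrightarrow> x \<otimes> \<zero> = \<zero>"
  using distrib_left[of \<zero> \<zero> x] mult_closed[of x \<zero>] add.r_cancel_one' by auto

lemma eval_rterm_closed:
  assumes "x \<in> rvars t \<rightarrow> carrier R" and "rconsts t \<subseteq> carrier R"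
  shows "eval_rterm R x t \<in> carrier R"
  using assms by (induction t) (auto simp: mult_closed Pi_iff)

end

section \<open>Closure of varieties under subpowers\<close>

text \<open>
  \<open>S\<close> is, up to isomorphism, a subring of the power of \<open>R\<close> over the index type \<open>'i\<close>, with
  coordinate projections \<open>\<phi> i\<close>. Negatives enter as an existence assumption because \<open>\<ominus>\<close> in \<open>S\<close>
  is meaningful only once \<open>S\<close> is known to be a group.
\<close>

locale subpower = R: nonunital_ring R for R (structure) +
  fixes S :: "'b ring" and \<phi> :: "'i \<Rightarrow> 'b \<Rightarrow> 'a"
  assumes zero_closed: "\<zero>\<^bsub>S\<^esub> \<in> carrier S"
    and add_closed: "\<And>x y. x \<in> carrier S \<Longrightarrow> y \<in> carrier S \<Longrightarrow> x \<oplus>\<^bsub>S\<^esub> y \<in> carrier S"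
    and mult_closed: "\<And>x y. x \<in> carrier S \<Longrightarrow> y \<in> carrier S \<Longrightarrow> x \<otimes>\<^bsub>S\<^esub> y \<in> carrier S"
    and coord_closed: "\<And>i x. x \<in> carrier S \<Longrightarrow> \<phi> i x \<in> carrier R"
    and coord_zero: "\<And>i. \<phi> i \<zero>\<^bsub>S\<^esub> = \<zero>"
    and coord_add: "\<And>i x y. x \<in> carrier S \<Longrightarrow> y \<in> carrier S \<Longrightarrow>
      \<phi> i (x \<oplus>\<^bsub>S\<^esub> y) = \<phi> i x \<oplus> \<phi> i y"
    and coord_mult: "\<And>i x y. x \<in> carrier S \<Longrightarrow> y \<in> carrier S \<Longrightarrow>
      \<phi> i (x \<otimes>\<^bsub>S\<^esub> y) = \<phi> i x \<otimes> \<phi> i y"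
    and neg_exists: "\<And>x. x \<in> carrier S \<Longrightarrow> \<exists>y\<in>carrier S. \<forall>i. \<phi> i y = \<ominus> \<phi> i x"
    and coord_eqI: "\<And>x y. x \<in> carrier S \<Longrightarrow> y \<in> carrier S \<Longrightarrow> (\<And>i. \<phi> i x = \<phi> i y) \<Longrightarrow> x = y"
begin

sublocale S: nonunital_ring S
proof -
  note closed = zero_closed add_closed mult_closed coord_closed
  note coord = coord_zero coord_add coord_mult
  have "abelian_group S"
  proof (rule abelian_groupI)
    fix x assume x: "x \<in> carrier S"
    obtain y where y: "y \<in> carrier S" "\<forall>i. \<phi> i y = \<ominus> \<phi> i x"
      using neg_exists[OF x] by blast
    have "y \<oplus>\<^bsub>S\<^esub> x = \<zero>\<^bsub>S\<^esub>"
      by (rule coord_eqI) (use x y in \<open>auto simp: closed coord R.l_neg\<close>)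
    then show "\<exists>y\<in>carrier S. y \<oplus>\<^bsub>S\<^esub> x = \<zero>\<^bsub>S\<^esub>" using y by blast
  qed (auto intro!: coord_eqI simp: closed coord R.a_ac)
  then show "nonunital_ring S"
    by (intro nonunital_ring.intro nonunital_ring_axioms.intro)
      (auto intro!: coord_eqI simp: closed coord R.mult_assoc R.distrib_left R.distrib_right)
qed

lemma coord_neg:
  assumes "x \<in> carrier S"
  shows "\<phi> i (\<ominus>\<^bsub>S\<^esub> x) = \<ominus> \<phi> i x"
proof -
  have "\<phi> i (\<ominus>\<^bsub>S\<^esub> x) \<oplus> \<phi> i x = \<zero>"
    using assms coord_add[of "\<ominus>\<^bsub>S\<^esub> x" x i] by (simp add: S.l_neg coord_zero)
  then show ?thesis
    using assms by (simp add: R.minus_equality coord_closed)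
qed

lemma coord_eval:
  assumes "x \<in> UNIV \<rightarrow> carrier S" and "rconsts t = {}"
  shows "\<phi> i (eval_rterm S x t) = eval_rterm R (\<lambda>v. \<phi> i (x v)) (map_rterm id (\<phi> i) t)"
  using assms
proof (induction t)
  case (Plus s t)
  then have "eval_rterm S x s \<in> carrier S" "eval_rterm S x t \<in> carrier S"
    by (auto intro!: S.eval_rterm_closed)
  with Plus show ?case by (simp add: coord_add)
next
  case (Times s t)
  then have "eval_rterm S x s \<in> carrier S" "eval_rterm S x t \<in> carrier S"
    by (auto intro!: S.eval_rterm_closed)
  with Times show ?case by (simp add: coord_mult)
next
  case (Neg t)
  then have "eval_rterm S x t \<in> carrier S"
    by (auto intro!: S.eval_rterm_closed)
  with Neg show ?case by (simp add: coord_neg)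
qed (auto simp: coord_zero)

end

text \<open>
  An identity carries a phantom type of constants, which is the element type of the ring it
  speaks about. Passing from \<open>R\<close> to \<open>S\<close> changes this type, so the identity is transported along
  an arbitrary map \<open>c\<close>; as no constants occur, all such maps have the same effect, and in
  coordinate \<open>i\<close> the map \<open>c\<close> can be exchanged for \<open>\<phi> i\<close>.
\<close>

lemma (in subpower) satisfies_identity_subpower:
  assumes "ring_identity (p, q)"
    and R: "satisfies_identity R (map_rterm id c p, map_rterm id c q)"
  shows "satisfies_identity S (p, q)"
proof -
  have constant_free: "rconsts p = {}" "rconsts q = {}"
    using assms by (auto simp: ring_identity_def)
  have eq: "eval_rterm S x p = eval_rterm S x q" if x: "x \<in> UNIV \<rightarrow> carrier S" for x
  proof (rule coord_eqI)
    show "eval_rterm S x p \<in> carrier S" "eval_rterm S x q \<in> carrier S"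
      using x constant_free by (auto intro!: S.eval_rterm_closed)
    fix i
    have "map_rterm id (\<phi> i) p = map_rterm id c p" "map_rterm id (\<phi> i) q = map_rterm id c q"
      using constant_free by (auto intro!: rterm.map_cong)
    moreover have "(\<lambda>v. \<phi> i (x v)) \<in> UNIV \<rightarrow> carrier R"
      using x by (auto simp: coord_closed Pi_iff)
    ultimately show "\<phi> i (eval_rterm S x p) = \<phi> i (eval_rterm S x q)"
      using R x constant_free by (simp add: coord_eval satisfies_identity_def)
  qed
  then show ?thesis by (simp add: satisfies_identity_def)
qed

lemma ring_variety_subpower:
  fixes R S :: "'a ring"
  assumes V: "ring_variety V" and R: "R \<in> V" and sub: "subpower R S \<phi>"
  shows "S \<in> V"
proof -
  interpret subpower R S \<phi> by (rule sub)
  obtain E where E: "\<forall>e\<in>E. ring_identity e"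
    and V_eq: "V = {R. nonunital_ring R \<and> (\<forall>e\<in>E. satisfies_identity R e)}"
    using V by (auto simp: ring_variety_def)
  have "satisfies_identity S (p, q)" if "(p, q) \<in> E" for p q
    by (rule satisfies_identity_subpower[where c = id])
      (use E R V_eq that in \<open>auto simp: rterm.map_id\<close>)
  then show ?thesis using V_eq S.nonunital_ring_axioms by auto
qed

section \<open>A ring that is not equationally Noetherian\<close>

instance rterm :: (countable, countable) countable
  by countable_datatype

text \<open>
  If no \<open>a k \<otimes> b k\<close> vanished, the system \<open>a k \<otimes> x = \<zero>\<close> would have no equivalent finite
  subsystem: the solution \<open>b l\<close> of the others violates the equation number \<open>l\<close>.
\<close>

lemma equationally_noetherian_no_orthogonal_sequences:
  fixes R (structure)
  assumes "equationally_noetherian R"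
    and a: "\<And>k :: nat. a k \<in> carrier R" and b: "\<And>k. b k \<in> carrier R"
    and off_diag: "\<And>k l. k \<noteq> l \<Longrightarrow> a k \<otimes> b l = \<zero>"
  shows "\<exists>k. a k \<otimes> b k = \<zero>"
proof (rule ccontr)
  assume "\<not> ?thesis"
  then have diag: "a k \<otimes> b k \<noteq> \<zero>" for k by blast
  define eqn :: "nat \<Rightarrow> 'a equation" where "eqn k = (Times (Const (a k)) (Var 0), Zero)" for k
  \<comment> \<open>The system must be infinite as a set of equations: \<open>b k\<close> tells \<open>a k\<close> from all other \<open>a l\<close>.\<close>
  have "inj a"
    by (rule injI) (metis diag off_diag)
  then have inj: "inj eqn"
    by (auto simp: inj_def eqn_def)
  have "infinite (range eqn)"
    by (rule range_inj_infinite[OF inj])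
  moreover have "\<forall>e\<in>range eqn. ring_equation R 1 e"
    using a by (auto simp: ring_equation_def eqn_def)
  ultimately obtain S' where S': "S' \<subseteq> range eqn" "finite S'"
    and sol: "solution_set R 1 S' = solution_set R 1 (range eqn)"
    using assms(1) unfolding equationally_noetherian_def by metis
  obtain I where I: "finite I" "S' = eqn ` I"
    using S' by (meson finite_subset_image)
  obtain l where "l \<notin> I"
    using I(1) ex_new_if_finite infinite_UNIV_nat by blast
  define x where "x = (\<lambda>v\<in>{..<1 :: nat}. b l)"
  have "x \<in> solution_set R 1 S'"
    using \<open>l \<notin> I\<close> b by (auto simp: solution_set_def I eqn_def x_def intro!: off_diag)
  moreover have "x \<notin> solution_set R 1 (range eqn)"
    using diag[of l] by (auto simp: solution_set_def eqn_def x_def)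
  ultimately show False using sol by simp
qed

text \<open>
  The full power of \<open>R\<close> may be too large for the universe \<open>'a\<close>. Its subring generated by the
  two sequences consists of the values of terms in countably many generators, so it is countable,
  and its operations can be moved to a subset of \<open>'a\<close> along an injection \<open>h\<close>.
\<close>

lemma subpower_with_orthogonal_sequences:
  fixes R :: "'a ring" (structure)
  assumes inf: "infinite (UNIV :: 'a set)" and "nonunital_ring R"
    and a: "a \<in> carrier R" and b: "b \<in> carrier R"
  obtains S :: "'a ring" and \<phi> :: "nat \<Rightarrow> 'a \<Rightarrow> 'a" and \<alpha> \<beta> :: "nat \<Rightarrow> 'a"
  where "subpower R S \<phi>"
    and "\<And>k. \<alpha> k \<in> carrier S" and "\<And>k. \<beta> k \<in> carrier S"
    and "\<And>i k. \<phi> i (\<alpha> k) = (if i = k then a else \<zero>)"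
    and "\<And>i k. \<phi> i (\<beta> k) = (if i = k then b else \<zero>)"
proof -
  interpret nonunital_ring R by fact
  \<comment> \<open>\<open>\<gamma> i v\<close> is coordinate \<open>i\<close> of the generator named \<open>v\<close>; the flag tells the two sequences apart.\<close>
  define \<gamma> where "\<gamma> i v = (if i = snd v then if fst v then a else b else \<zero>)"
    for i :: nat and v :: "bool \<times> nat"
  \<comment> \<open>Constants have type \<open>unit\<close> to keep the set of terms countable; they all denote \<open>\<zero>\<close>.\<close>
  define ev where "ev t i = eval_rterm R (\<gamma> i) (map_rterm id (\<lambda>_. \<zero>) t)"
    for t :: "(bool \<times> nat, unit) rterm" and i
  have "countable (range ev)" by simp
  obtain h :: "(nat \<Rightarrow> 'a) \<Rightarrow> 'a" where h: "inj_on h (range ev)"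
  proof -
    obtain f :: "nat \<Rightarrow> 'a" where "inj f"
      using inf infinite_countable_subset by blast
    then have "inj_on (f \<circ> to_nat_on (range ev)) (range ev)"
      by (intro comp_inj_on) (auto intro: inj_on_to_nat_on inj_on_subset)
    then show thesis by (rule that)
  qed
  define g where "g = inv_into (range ev) h"
  have g: "g (h (ev t)) = ev t" for t
    unfolding g_def by (rule inv_into_f_f[OF h]) simp
  define S :: "'a ring" where "S = \<lparr>carrier = range (\<lambda>t. h (ev t)),
    mult = (\<lambda>x y. h (\<lambda>i. g x i \<otimes> g y i)), one = undefined,
    zero = h (\<lambda>i. \<zero>), add = (\<lambda>x y. h (\<lambda>i. g x i \<oplus> g y i))\<rparr>"
  have ev_apply: "ev Zero i = \<zero>" "ev (Plus s t) i = ev s i \<oplus> ev t i"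
    "ev (Times s t) i = ev s i \<otimes> ev t i" "ev (Neg t) i = \<ominus> ev t i" for s t i
    by (simp_all add: ev_def)
  have ev_lambda: "(\<lambda>i. \<zero>) = ev Zero" "(\<lambda>i. ev s i \<oplus> ev t i) = ev (Plus s t)"
    "(\<lambda>i. ev s i \<otimes> ev t i) = ev (Times s t)" for s t
    by (simp_all add: fun_eq_iff ev_apply)
  have ev_closed: "ev t i \<in> carrier R" for t i
    unfolding ev_def by (rule eval_rterm_closed) (auto simp: \<gamma>_def a b rterm.set_map)
  have "subpower R S (\<lambda>i x. g x i)"
  proof unfold_locales
    show "\<And>x. x \<in> carrier S \<Longrightarrow> \<exists>y\<in>carrier S. \<forall>i. g y i = \<ominus> g x i"
    proof -
      fix x assume "x \<in> carrier S"
      then obtain t where "x = h (ev t)" by (auto simp: S_def)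
      then have "\<forall>i. g (h (ev (Neg t))) i = \<ominus> g x i"
        by (simp add: g ev_apply)
      then show "\<exists>y\<in>carrier S. \<forall>i. g y i = \<ominus> g x i" by (auto simp: S_def)
    qed
  next
    fix x y assume "x \<in> carrier S" "y \<in> carrier S" "\<And>i. g x i = g y i"
    then have "g x = g y" by blast
    with \<open>x \<in> carrier S\<close> \<open>y \<in> carrier S\<close> show "x = y" by (auto simp: S_def g)
  qed (auto simp: S_def g ev_lambda ev_apply ev_closed)
  moreover have "h (ev t) \<in> carrier S" for t by (simp add: S_def)
  moreover have "g (h (ev (Var (c, k)))) i = (if i = k then if c then a else b else \<zero>)" for c k i
    by (simp add: g) (simp add: ev_def \<gamma>_def)
  ultimately show thesis
    by (intro that[of S "\<lambda>i x. g x i" "\<lambda>k. h (ev (Var (True, k)))" "\<lambda>k. h (ev (Var (False, k)))"])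
      auto
qed

lemma variety_zero_mult_if_noetherian:
  fixes V :: "'a ring set" and R (structure)
  assumes inf: "infinite (UNIV :: 'a set)" and V: "ring_variety V"
    and noeth: "\<forall>R\<in>V. equationally_noetherian R"
    and R: "R \<in> V" and a: "a \<in> carrier R" and b: "b \<in> carrier R"
  shows "a \<otimes> b = \<zero>"
proof -
  have "nonunital_ring R"
    using V R by (auto simp: ring_variety_def)
  then interpret nonunital_ring R .
  obtain S :: "'a ring" and \<phi> :: "nat \<Rightarrow> 'a \<Rightarrow> 'a" and \<alpha> \<beta> where sub: "subpower R S \<phi>"
    and \<alpha>: "\<And>k. \<alpha> k \<in> carrier S" and \<beta>: "\<And>k. \<beta> k \<in> carrier S"
    and coord_\<alpha>: "\<And>i k. \<phi> i (\<alpha> k) = (if i = k then a else \<zero>)"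
    and coord_\<beta>: "\<And>i k. \<phi> i (\<beta> k) = (if i = k then b else \<zero>)"
    by (rule subpower_with_orthogonal_sequences[OF inf \<open>nonunital_ring R\<close> a b]) blast
  interpret subpower R S \<phi> by (rule sub)
  have "equationally_noetherian S"
    using noeth ring_variety_subpower[OF V R sub] by blast
  moreover have "\<alpha> k \<otimes>\<^bsub>S\<^esub> \<beta> l = \<zero>\<^bsub>S\<^esub>" if "k \<noteq> l" for k l
    by (rule coord_eqI)
      (use that \<alpha> \<beta> a b in \<open>auto simp: S.mult_closed coord_mult coord_zero coord_\<alpha> coord_\<beta>
        zero_mult_left zero_mult_right\<close>)
  ultimately obtain k where "\<alpha> k \<otimes>\<^bsub>S\<^esub> \<beta> k = \<zero>\<^bsub>S\<^esub>"
    using equationally_noetherian_no_orthogonal_sequences[of S \<alpha> \<beta>] \<alpha> \<beta> by blast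
  then have "\<phi> k (\<alpha> k) \<otimes> \<phi> k (\<beta> k) = \<zero>"
    using coord_mult[OF \<alpha> \<beta>, of k k k] coord_zero by simp
  then show ?thesis by (simp add: coord_\<alpha> coord_\<beta>)
qed

section \<open>Finite generation in groups of integer vectors\<close>

text \<open>Closure under differences, together with \<open>0\<close>, yields the additive subgroup generated by \<open>A\<close>.\<close>

inductive_set int_span :: "(nat \<Rightarrow> int) set \<Rightarrow> (nat \<Rightarrow> int) set" for A where
  base: "v \<in> A \<Longrightarrow> v \<in> int_span A"
| zero: "(\<lambda>_. 0) \<in> int_span A"
| diff: "u \<in> int_span A \<Longrightarrow> v \<in> int_span A \<Longrightarrow> (\<lambda>i. u i - v i) \<in> int_span A"

lemma int_span_add:
  assumes "u \<in> int_span A" "v \<in> int_span A"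
  shows "(\<lambda>i. u i + v i) \<in> int_span A"
  using int_span.diff[OF assms(1) int_span.diff[OF int_span.zero assms(2)]] by simp

lemma int_span_scale:
  assumes "v \<in> int_span A"
  shows "(\<lambda>i. k * v i) \<in> int_span A"
proof (induction k rule: int_induct[where k = 0])
  case base
  show ?case by (simp add: int_span.zero)
next
  case (step1 k)
  then show ?case using int_span_add[OF step1(2) assms] by (simp add: algebra_simps)
next
  case (step2 k)
  then show ?case using int_span.diff[OF step2(2) assms] by (simp add: algebra_simps)
qed

lemma int_span_mono: "v \<in> int_span A \<Longrightarrow> A \<subseteq> B \<Longrightarrow> v \<in> int_span B"
  by (induction rule: int_span.induct) (auto intro: int_span.intros)

lemma int_span_finite_support:
  "v \<in> int_span A \<Longrightarrow> \<exists>F\<subseteq>A. finite F \<and> v \<in> int_span F"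
proof (induction rule: int_span.induct)
  case (base v)
  then show ?case by (intro exI[of _ "{v}"]) (auto intro: int_span.base)
next
  case zero
  show ?case by (intro exI[of _ "{}"]) (auto intro: int_span.zero)
next
  case (diff u v)
  then obtain F G where "F \<subseteq> A" "finite F" "u \<in> int_span F" "G \<subseteq> A" "finite G" "v \<in> int_span G"
    by blast
  then show ?case
    by (intro exI[of _ "F \<union> G"]) (auto intro!: int_span.diff intro: int_span_mono)
qed

text \<open>
  This says that \<open>\<int>\<^sup>n\<close> is Noetherian: seen in the first \<open>n\<close> coordinates, the subgroup generated by
  \<open>A\<close> is generated by finitely many members of \<open>A\<close>. In the induction, the vectors of the
  subgroup that vanish in the first \<open>n\<close> coordinates have as their entries at position \<open>n\<close> a
  subgroup of \<open>\<int>\<close>, which is cyclic. Multiples of a vector \<open>g\<close> whose entry is a generator correct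
  the entry at position \<open>n\<close> in the approximations given by the induction hypothesis.
\<close>

lemma int_span_finitely_generated:
  "\<exists>F\<subseteq>A. finite F \<and> (\<forall>v\<in>int_span A. \<exists>w\<in>int_span F. \<forall>i<n. v i = w i)"
proof (induction n)
  case 0
  show ?case by (intro exI[of _ "{}"]) (auto intro: int_span.zero)
next
  case (Suc n)
  then obtain F where F: "F \<subseteq> A" "finite F"
    and approx: "\<And>v. v \<in> int_span A \<Longrightarrow> \<exists>w\<in>int_span F. \<forall>i<n. v i = w i"
    by blast
  define K where "K = {v \<in> int_span A. \<forall>i<n. v i = 0}"
  obtain g where g: "g \<in> K" and g_dvd: "\<And>v. v \<in> K \<Longrightarrow> g n dvd v n"
  proof (cases "\<exists>v\<in>K. v n \<noteq> 0")
    case True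
    then obtain g where g: "g \<in> K" "g n \<noteq> 0"
      and least: "\<And>v. v \<in> K \<Longrightarrow> v n \<noteq> 0 \<Longrightarrow> nat \<bar>g n\<bar> \<le> nat \<bar>v n\<bar>"
      using ex_has_least_nat[of "\<lambda>v. v \<in> K \<and> v n \<noteq> 0" _ "\<lambda>v. nat \<bar>v n\<bar>"] by blast
    have "g n dvd v n" if v: "v \<in> K" for v
    proof (rule ccontr)
      assume "\<not> g n dvd v n"
      \<comment> \<open>Division with remainder: \<open>r\<close> would have a smaller nonzero entry than \<open>g\<close>.\<close>
      define r where "r = (\<lambda>i. v i - (v n div g n) * g i)"
      have "r \<in> K"
        using v g by (auto simp: K_def r_def intro!: int_span.diff int_span_scale)
      moreover have "r n = v n mod g n"
        by (simp add: r_def minus_div_mult_eq_mod)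
      moreover have "v n mod g n \<noteq> 0"
        using \<open>\<not> g n dvd v n\<close> by (simp add: dvd_eq_mod_eq_0)
      ultimately show False
        using least[of r] abs_mod_less[OF g(2), of "v n"] by auto
    qed
    with g that show thesis by blast
  next
    case False
    then show thesis
      by (intro that[of "\<lambda>_. 0"]) (auto simp: K_def int_span.zero)
  qed
  obtain G where G: "G \<subseteq> A" "finite G" "g \<in> int_span G"
    using g int_span_finite_support[of g A] by (auto simp: K_def)
  have "\<exists>w\<in>int_span (F \<union> G). \<forall>i<Suc n. v i = w i" if v: "v \<in> int_span A" for v
  proof -
    obtain w where w: "w \<in> int_span F" "\<forall>i<n. v i = w i"
      using approx[OF v] by blast
    have "(\<lambda>i. v i - w i) \<in> K"
      using v w F by (auto simp: K_def intro: int_span.diff int_span_mono)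
    then obtain k where k: "v n - w n = g n * k"
      using g_dvd by (blast elim: dvdE)
    have "(\<lambda>i. w i + k * g i) \<in> int_span (F \<union> G)"
      using w G by (intro int_span_add int_span_scale) (auto intro: int_span_mono)
    moreover have "\<forall>i<Suc n. v i = w i + k * g i"
      using w k g by (auto simp: less_Suc_eq K_def algebra_simps)
    ultimately show ?thesis by (intro bexI[of _ "\<lambda>i. w i + k * g i"])
  qed
  then show ?case using F G by (intro exI[of _ "F \<union> G"]) auto
qed

section \<open>Rings with zero multiplication\<close>

text \<open>
  The coefficients of the linear part of a term. A product contributes nothing, since this is
  meant for rings in which all products vanish.
\<close>

primrec coef :: "('v, 'c) rterm \<Rightarrow> 'v \<Rightarrow> int" where
  "coef (Var v) = (\<lambda>i. if i = v then 1 else 0)"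
| "coef (Const c) = (\<lambda>_. 0)"
| "coef Zero = (\<lambda>_. 0)"
| "coef (Plus s t) = (\<lambda>i. coef s i + coef t i)"
| "coef (Neg t) = (\<lambda>i. - coef t i)"
| "coef (Times s t) = (\<lambda>_. 0)"

context nonunital_ring
begin

definition linear_form :: "nat \<Rightarrow> (nat \<Rightarrow> int) \<Rightarrow> (nat \<Rightarrow> 'a) \<Rightarrow> 'a" where
  "linear_form n m x = (\<Oplus>i\<in>{..<n}. [m i] \<cdot> x i)"

lemma linear_form_closed [simp]:
  "x \<in> {..<n} \<rightarrow> carrier R \<Longrightarrow> linear_form n m x \<in> carrier R"
  unfolding linear_form_def by (auto intro!: finsum_closed add.int_pow_closed)

lemma linear_form_zero [simp]: "linear_form n (\<lambda>_. 0) x = \<zero>"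
  unfolding linear_form_def by (simp add: add_pow_def int_pow_def2)

lemma linear_form_add:
  assumes "x \<in> {..<n} \<rightarrow> carrier R"
  shows "linear_form n (\<lambda>i. u i + v i) x = linear_form n u x \<oplus> linear_form n v x"
proof -
  have "linear_form n (\<lambda>i. u i + v i) x = (\<Oplus>i\<in>{..<n}. [u i] \<cdot> x i \<oplus> [v i] \<cdot> x i)"
    unfolding linear_form_def
    by (rule add.finprod_cong') (use assms in \<open>auto simp: add.int_pow_mult Pi_iff\<close>)
  also have "\<dots> = linear_form n u x \<oplus> linear_form n v x"
    unfolding linear_form_def using assms by (intro finsum_addf) auto
  finally show ?thesis .
qed

lemma linear_form_neg:
  assumes x: "x \<in> {..<n} \<rightarrow> carrier R"
  shows "linear_form n (\<lambda>i. - u i) x = \<ominus> linear_form n u x"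
  using linear_form_add[OF x, of "\<lambda>i. - u i" u] linear_form_closed[OF x]
  by (simp add: minus_equality)

lemma linear_form_diff:
  assumes x: "x \<in> {..<n} \<rightarrow> carrier R"
  shows "linear_form n (\<lambda>i. u i - v i) x = linear_form n u x \<ominus> linear_form n v x"
  using linear_form_add[OF x, of u "\<lambda>i. - v i"] linear_form_neg[OF x] by (simp add: minus_eq)

lemma linear_form_unit:
  assumes x: "x \<in> {..<n} \<rightarrow> carrier R" and "v < n"
  shows "linear_form n (\<lambda>i. if i = v then 1 else 0) x = x v"
proof -
  have "linear_form n (\<lambda>i. if i = v then 1 else 0) x = (\<Oplus>i\<in>{..<n}. if v = i then x i else \<zero>)"
    unfolding linear_form_def
    by (rule add.finprod_cong') (use assms in \<open>auto simp: Pi_iff add_pow_def int_pow_def2\<close>)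
  also have "\<dots> = x v"
    by (rule add.finprod_singleton) (use assms in auto)
  finally show ?thesis .
qed

lemma linear_form_cong:
  "x \<in> {..<n} \<rightarrow> carrier R \<Longrightarrow> (\<And>i. i < n \<Longrightarrow> u i = v i) \<Longrightarrow> linear_form n u x = linear_form n v x"
  unfolding linear_form_def by (rule add.finprod_cong') (auto simp: Pi_iff)

end

locale zero_mult_ring = nonunital_ring +
  assumes mult_zero: "\<And>a b. a \<in> carrier R \<Longrightarrow> b \<in> carrier R \<Longrightarrow> a \<otimes> b = \<zero>"
begin

lemma eval_affine:
  assumes x: "x \<in> {..<n} \<rightarrow> carrier R" and "rvars t \<subseteq> {..<n}" and "rconsts t \<subseteq> carrier R"
  shows "eval_rterm R x t = linear_form n (coef t) x \<oplus> eval_rterm R (\<lambda>_. \<zero>) t"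
  using assms(2,3)
proof (induction t)
  case (Var v)
  then show ?case using x by (auto simp: linear_form_unit Pi_iff)
next
  case (Const c)
  then show ?case by simp
next
  case Zero
  then show ?case by simp
next
  case (Plus s t)
  then have "eval_rterm R (\<lambda>_. \<zero>) s \<in> carrier R" "eval_rterm R (\<lambda>_. \<zero>) t \<in> carrier R"
    by (auto intro!: eval_rterm_closed)
  with Plus x show ?case by (simp add: linear_form_add a_ac)
next
  case (Neg t)
  then have "eval_rterm R (\<lambda>_. \<zero>) t \<in> carrier R"
    by (auto intro!: eval_rterm_closed)
  with Neg x show ?case by (simp add: linear_form_neg minus_add)
next
  case (Times s t)
  have "y \<in> rvars s \<union> rvars t \<rightarrow> carrier R \<Longrightarrow> eval_rterm R y s \<otimes> eval_rterm R y t = \<zero>" for y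
    using Times by (intro mult_zero) (auto intro!: eval_rterm_closed)
  moreover have "x \<in> rvars s \<union> rvars t \<rightarrow> carrier R" using Times x by auto
  ultimately show ?case by simp
qed

lemma equation_iff_linear_form:
  assumes x: "x \<in> {..<n} \<rightarrow> carrier R" and e: "ring_equation R n (p, q)"
  shows "eval_rterm R x p = eval_rterm R x q \<longleftrightarrow>
    linear_form n (\<lambda>i. coef p i - coef q i) x =
    eval_rterm R (\<lambda>_. \<zero>) q \<ominus> eval_rterm R (\<lambda>_. \<zero>) p"
proof -
  have closed: "eval_rterm R (\<lambda>_. \<zero>) p \<in> carrier R" "eval_rterm R (\<lambda>_. \<zero>) q \<in> carrier R"
    using e by (auto intro!: eval_rterm_closed simp: ring_equation_def)
  have swap: "l \<oplus> c = m \<oplus> d \<longleftrightarrow> l \<ominus> m = d \<ominus> c"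
    if "l \<in> carrier R" "m \<in> carrier R" "c \<in> carrier R" "d \<in> carrier R" for l m c d
  proof -
    have "l \<oplus> c = m \<oplus> d \<longleftrightarrow> (l \<oplus> c) \<oplus> (\<ominus> m \<oplus> \<ominus> c) = (m \<oplus> d) \<oplus> (\<ominus> m \<oplus> \<ominus> c)"
      using that by simp
    also have "(l \<oplus> c) \<oplus> (\<ominus> m \<oplus> \<ominus> c) = (l \<ominus> m) \<oplus> (c \<oplus> \<ominus> c)"
      using that by (simp add: minus_eq a_ac)
    also have "(m \<oplus> d) \<oplus> (\<ominus> m \<oplus> \<ominus> c) = (d \<ominus> c) \<oplus> (m \<oplus> \<ominus> m)"
      using that by (simp add: minus_eq a_ac)
    finally show ?thesis using that by (simp add: r_neg minus_eq)
  qed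
  show ?thesis
    using e x closed
    by (auto simp: ring_equation_def eval_affine[OF x] linear_form_diff swap)
qed

text \<open>
  Linear forms are additive in their coefficients, so constancy on a set \<open>X\<close> of points passes
  from generators to the whole group of coefficient vectors that they generate.
\<close>

lemma linear_form_constant_on_span:
  assumes X: "\<And>x. x \<in> X \<Longrightarrow> x \<in> {..<n} \<rightarrow> carrier R"
    and base: "\<And>m. m \<in> M \<Longrightarrow> \<exists>c. \<forall>x\<in>X. linear_form n m x = c"
    and v: "v \<in> int_span M"
  shows "\<exists>c. \<forall>x\<in>X. linear_form n v x = c"
  using v
proof (induction rule: int_span.induct)
  case (diff u v)
  then show ?case by (metis X linear_form_diff)
qed (auto intro: base)

text \<open>
  The dichotomy below does the work: each equation of \<open>S\<close> holds everywhere or nowhere on the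
  solution set \<open>X\<close> of a suitable finite subsystem \<open>F\<close>, because its linear part is constant there.
  This also covers inconsistent systems, where it yields a finite inconsistent subsystem.
\<close>

lemma equationally_noetherian: "equationally_noetherian R"
  unfolding equationally_noetherian_def
proof (intro allI impI)
  fix n and S :: "'a equation set"
  assume "infinite S \<and> (\<forall>e\<in>S. ring_equation R n e)"
  then have S: "ring_equation R n (p, q)" if "(p, q) \<in> S" for p q using that by blast
  define lin :: "'a equation \<Rightarrow> nat \<Rightarrow> int" where "lin = (\<lambda>(p, q) i. coef p i - coef q i)"
  obtain M where M: "M \<subseteq> lin ` S" "finite M"
    and approx: "\<And>v. v \<in> int_span (lin ` S) \<Longrightarrow> \<exists>w\<in>int_span M. \<forall>i<n. v i = w i"
    using int_span_finitely_generated[of "lin ` S" n] by blast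
  obtain F where F: "F \<subseteq> S" "finite F" "M = lin ` F"
    using M by (meson finite_subset_image)
  define X where "X = solution_set R n F"
  have X: "x \<in> {..<n} \<rightarrow> carrier R" if "x \<in> X" for x
    using that by (auto simp: X_def solution_set_def PiE_def)
  have M_const: "\<exists>c. \<forall>x\<in>X. linear_form n m x = c" if "m \<in> M" for m
  proof -
    obtain p q where pq: "(p, q) \<in> F" "m = lin (p, q)" using \<open>m \<in> M\<close> F by auto
    then have "\<forall>x\<in>X. eval_rterm R x p = eval_rterm R x q"
      by (auto simp: X_def solution_set_def)
    then show ?thesis
      using equation_iff_linear_form[OF X S, of _ p q] pq F(1) by (auto simp: lin_def)
  qed
  have dichotomy: "(\<forall>x\<in>X. eval_rterm R x p = eval_rterm R x q) \<or>
      (\<forall>x\<in>X. eval_rterm R x p \<noteq> eval_rterm R x q)" if pq: "(p, q) \<in> S" for p q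
  proof -
    have "lin (p, q) \<in> int_span (lin ` S)" using pq by (auto intro: int_span.base)
    then obtain w where w: "w \<in> int_span M" "\<forall>i<n. lin (p, q) i = w i"
      using approx by blast
    obtain c where "\<forall>x\<in>X. linear_form n w x = c"
      using linear_form_constant_on_span[OF X M_const w(1)] by blast
    then have "\<forall>x\<in>X. linear_form n (lin (p, q)) x = c"
      using w(2) linear_form_cong[OF X, of _ "lin (p, q)" w] by auto
    then show ?thesis
      using equation_iff_linear_form[OF X S[OF pq]] by (auto simp: lin_def)
  qed
  show "\<exists>S'\<subseteq>S. finite S' \<and> solution_set R n S' = solution_set R n S"
  proof (cases "\<exists>p q. (p, q) \<in> S \<and> (\<forall>x\<in>X. eval_rterm R x p \<noteq> eval_rterm R x q)")
    case True
    then obtain p q where pq: "(p, q) \<in> S" "\<forall>x\<in>X. eval_rterm R x p \<noteq> eval_rterm R x q"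
      by blast
    have "solution_set R n (insert (p, q) F) = {x \<in> X. eval_rterm R x p = eval_rterm R x q}"
      by (auto simp: X_def solution_set_def)
    also have "\<dots> = {}" using pq by blast
    finally have "solution_set R n (insert (p, q) F) = {}" .
    moreover have "solution_set R n S \<subseteq> solution_set R n (insert (p, q) F)"
      using pq F by (auto simp: solution_set_def)
    ultimately show ?thesis using pq F by (intro exI[of _ "insert (p, q) F"]) auto
  next
    case False
    then have "\<forall>(p, q)\<in>S. \<forall>x\<in>X. eval_rterm R x p = eval_rterm R x q"
      using dichotomy by blast
    then have "solution_set R n F = solution_set R n S"
      using F by (fastforce simp: X_def solution_set_def)
    then show ?thesis using F by blast
  qed
qed

end

theorem theorem4p3:
  fixes V :: "'a ring set"
  assumes "infinite (UNIV :: 'a set)"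
    and "ring_variety V"
  shows "(\<forall>R\<in>V. equationally_noetherian R) \<longleftrightarrow>
         (\<forall>R\<in>V. \<forall>a\<in>carrier R. \<forall>b\<in>carrier R. a \<otimes>\<^bsub>R\<^esub> b = \<zero>\<^bsub>R\<^esub>)"
proof
  assume "\<forall>R\<in>V. equationally_noetherian R"
  then show "\<forall>R\<in>V. \<forall>a\<in>carrier R. \<forall>b\<in>carrier R. a \<otimes>\<^bsub>R\<^esub> b = \<zero>\<^bsub>R\<^esub>"
    using variety_zero_mult_if_noetherian[OF assms] by blast
next
  assume zero: "\<forall>R\<in>V. \<forall>a\<in>carrier R. \<forall>b\<in>carrier R. a \<otimes>\<^bsub>R\<^esub> b = \<zero>\<^bsub>R\<^esub>"
  show "\<forall>R\<in>V. equationally_noetherian R"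
  proof
    fix R assume "R \<in> V"
    then have "nonunital_ring R"
      using assms(2) by (auto simp: ring_variety_def)
    then have "zero_mult_ring R"
      using zero \<open>R \<in> V\<close> by (simp add: zero_mult_ring_def zero_mult_ring_axioms_def)
    then show "equationally_noetherian R"
      by (rule zero_mult_ring.equationally_noetherian)
  qed
qed

end
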